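(* Let $k\in\mathbb{R}$ and let $w_A,w_B:\mathbb{R}\to\mathbb{C}$ be $C^\infty$ functions with $w_A\neq\overline{w_B}$ and $w_A(x)+w_B(x)=x+k$ for all $x\in\mathbb{R}$. With $\varphi_0,\Psi_0$ and the differential operators $B$, $A^\dagger$ as in the context, let $$\varphi_n=\frac{1}{\sqrt{n!}}\,B^n\varphi_0,\qquad \Psi_n=\frac{1}{\sqrt{n!}}\,(A^\dagger)^n\Psi_0,\qquad n\geq 0.$$ Then, for all $n\geq0$ and all $x\in\mathbb{R}$, $$\frac{\varphi_n(x)}{\varphi_0(x)}=\frac{\Psi_n(x)}{\Psi_0(x)}=p_n(x,k),$$ where $p_n(x,k)$ does not depend on $w_A$ and $w_B$ and is defined recursively by $$p_0(x,k)=1,\qquad p_n(x,k)=\frac{1}{\sqrt{n}}\Big((x+k)\,p_{n-1}(x,k)-p_{n-1}'(x,k)\Big),\quad n\geq1,$$ the prime denoting the derivative with respect to $x$. Moreover, for all $n\geq0$, $$p_n(x,k)=\frac{1}{\sqrt{2^n\,n!}}\,H_n\!\left(\frac{x+k}{\sqrt2}\right).$$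
   Context: $H_n$ is the $n$-th (physicists') Hermite polynomial, $H_n(y)=(-1)^n e^{y^2}\frac{d^n}{dy^n}e^{-y^2}$. The operators $B=-\frac{d}{dx}+w_B(x)$ and $A^\dagger=-\frac{d}{dx}+\overline{w_A(x)}$ act as differential expressions on $C^\infty$ functions $\mathbb{R}\to\mathbb{C}$ (no square-integrability is required). Let $s_A,s_B$ be primitives of $w_A,w_B$ (so $s_A'=w_A$, $s_B'=w_B$), with integration constants chosen so that $s_A(x)+s_B(x)=\frac{x^2}{2}+kx$. Then $$\varphi_0(x)=N_\varphi\,e^{-s_A(x)},\qquad \Psi_0(x)=N_\Psi\,e^{-\overline{s_B(x)}},$$ where $N_\varphi,N_\Psi\in\mathbb{C}$ are nonzero constants with $N_\varphi\overline{N_\Psi}=\frac{e^{-k^2/2}}{\sqrt{2\pi}}$. *)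

theory Defs
  imports "HOL-Analysis.Analysis"
begin

abbreviation ddx :: "(real \<Rightarrow> complex) \<Rightarrow> real \<Rightarrow> complex"
  where "ddx f \<equiv> (\<lambda>x. vector_derivative f (at x))"

definition smooth :: "(real \<Rightarrow> complex) \<Rightarrow> bool"
  where "smooth f \<longleftrightarrow> (\<forall>n x. (ddx ^^ n) f differentiable (at x))"

(* Both operators are total on functions; they carry their intended meaning on
   smooth functions, since ddx is unspecified where the derivative does not exist. *)

definition op_B :: "(real \<Rightarrow> complex) \<Rightarrow> (real \<Rightarrow> complex) \<Rightarrow> real \<Rightarrow> complex"
  where "op_B w\<^sub>B f = (\<lambda>x. - ddx f x + w\<^sub>B x * f x)"

definition op_A_dagger :: "(real \<Rightarrow> complex) \<Rightarrow> (real \<Rightarrow> complex) \<Rightarrow> real \<Rightarrow> complex"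
  where "op_A_dagger w\<^sub>A f = (\<lambda>x. - ddx f x + cnj (w\<^sub>A x) * f x)"

(* The vacua depend on the normalisation constant N and on the chosen primitive s
   (of w_A for phi0, of w_B for Psi0). *)

definition phi0 :: "complex \<Rightarrow> (real \<Rightarrow> complex) \<Rightarrow> real \<Rightarrow> complex"
  where "phi0 N s\<^sub>A = (\<lambda>x. N * exp (- s\<^sub>A x))"

definition Psi0 :: "complex \<Rightarrow> (real \<Rightarrow> complex) \<Rightarrow> real \<Rightarrow> complex"
  where "Psi0 N s\<^sub>B = (\<lambda>x. N * exp (- cnj (s\<^sub>B x)))"

definition phi ::
  "(real \<Rightarrow> complex) \<Rightarrow> (real \<Rightarrow> complex) \<Rightarrow> nat \<Rightarrow> real \<Rightarrow> complex"
  where "phi w\<^sub>B \<phi>\<^sub>0 n = (\<lambda>x. complex_of_real (1 / sqrt (fact n)) * (op_B w\<^sub>B ^^ n) \<phi>\<^sub>0 x)"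

definition Psi ::
  "(real \<Rightarrow> complex) \<Rightarrow> (real \<Rightarrow> complex) \<Rightarrow> nat \<Rightarrow> real \<Rightarrow> complex"
  where "Psi w\<^sub>A \<Psi>\<^sub>0 n = (\<lambda>x. complex_of_real (1 / sqrt (fact n)) * (op_A_dagger w\<^sub>A ^^ n) \<Psi>\<^sub>0 x)"

primrec p :: "nat \<Rightarrow> real \<Rightarrow> real \<Rightarrow> real"
  where
    "p 0 k = (\<lambda>x. 1)"
  | "p (Suc n) k = (\<lambda>x. 1 / sqrt (real (Suc n)) * ((x + k) * p n k x - deriv (p n k) x))"

(* physicists' convention *)
definition Hermite :: "nat \<Rightarrow> real \<Rightarrow> real"
  where "Hermite n y = (-1) ^ n * exp (y\<^sup>2) * (deriv ^^ n) (\<lambda>t. exp (- t\<^sup>2)) y"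

end

(* A vacuum phi0 satisfies phi0' = - v phi0 with v + w = x + k, where w is the zeroth-order term
   of the raising operator. Hence that operator maps q phi0 to ((x + k) q - q') phi0 for every
   differentiable q, which is the recursion of p up to normalisation. The Rodrigues
   formula gives the same recursion: -d/dt (q exp (-t^2)) = (2 t q - q') exp (-t^2) becomes it
   under the substitution x + k = sqrt 2 * t. *)

theory Submission
  imports Defs "HOL-Computational_Algebra.Polynomial"
begin

text \<open>The recursion of \<open>p\<close> uses \<open>deriv\<close>, which is informative only
  where a derivative exists. Being polynomial guarantees this at every stage.\<close>

lemma p_eq_poly: "\<exists>q. p n k = poly q"
proof (induction n)
  case 0
  have "p 0 k = poly 1" by auto
  then show ?case by blast
next
  case (Suc n)
  then obtain q where q: "p n k = poly q" by blast
  have "p (Suc n) k = poly (smult (1 / sqrt (real (Suc n))) ([:k, 1:] * q - pderiv q))"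
    by (rule ext) (simp add: q DERIV_imp_deriv[OF poly_DERIV] algebra_simps)
  then show ?case by blast
qed

lemma p_has_field_derivative: "(p n k has_field_derivative deriv (p n k) x) (at x)"
proof -
  obtain q where "p n k = poly q" using p_eq_poly by blast
  then show ?thesis by (simp add: DERIV_imp_deriv[OF poly_DERIV])
qed

text \<open>The weight \<open>sqrt (fact n)\<close> absorbs the factor
  \<open>1 / sqrt (real (Suc n))\<close>. What remains is the unnormalised recursion met both by the
  raising operators and by the derivatives of the Gaussian.\<close>

lemma sqrt_fact_Suc_mult_p:
  "sqrt (fact (Suc n)) * p (Suc n) k x = sqrt (fact n) * ((x + k) * p n k x - deriv (p n k) x)"
  by (simp add: real_sqrt_mult del: of_nat_Suc)

text \<open>Keeping \<open>v\<close> and \<open>w\<close> abstract lets one induction serve both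
  families, whose coefficients are exchanged and conjugated.\<close>

lemma op_B_funpow_vacuum:
  assumes f: "\<And>x. (f has_vector_derivative - v x * f x) (at x)"
    and vw: "\<And>x. v x + w x = complex_of_real (x + k)"
  shows "(op_B w ^^ n) f = (\<lambda>x. complex_of_real (sqrt (fact n) * p n k x) * f x)"
proof (induction n)
  case 0
  show ?case by simp
next
  case (Suc n)
  show ?case
  proof
    fix x
    let ?c = "sqrt (fact n)" and ?P = "p n k x" and ?D = "deriv (p n k) x"
    have "((\<lambda>x. ?c * p n k x) has_field_derivative ?c * ?D) (at x)"
      by (rule DERIV_cmult[OF p_has_field_derivative])
    from has_vector_derivative_mult[OF has_vector_derivative_of_real[OF this] f]
    have "ddx (\<lambda>x. complex_of_real (?c * p n k x) * f x) x
        = complex_of_real (?c * ?P) * (- v x * f x) + complex_of_real (?c * ?D) * f x"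
      by (rule vector_derivative_at)
    \<comment> \<open>The minus sign in \<open>op_B\<close> turns \<open>- v\<close> into
      \<open>v\<close>, so the two coefficients enter only through their sum.\<close>
    then have "(op_B w ^^ Suc n) f x
        = complex_of_real (?c * ?P) * (v x + w x) * f x - complex_of_real (?c * ?D) * f x"
      by (simp add: Suc op_B_def algebra_simps)
    also have "\<dots> = complex_of_real (?c * ((x + k) * ?P - ?D)) * f x"
      unfolding vw by (simp add: algebra_simps)
    finally show "(op_B w ^^ Suc n) f x
        = complex_of_real (sqrt (fact (Suc n)) * p (Suc n) k x) * f x"
      unfolding sqrt_fact_Suc_mult_p .
  qed
qed

lemma phi_div_vacuum:
  assumes "\<And>x. (f has_vector_derivative - v x * f x) (at x)"
    and "\<And>x. v x + w x = complex_of_real (x + k)"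
    and "f x \<noteq> 0"
  shows "phi w f n x / f x = complex_of_real (p n k x)"
  using assms(3) by (simp add: phi_def op_B_funpow_vacuum[OF assms(1,2)])

text \<open>Conjugating the coefficient turns \<open>op_A_dagger\<close> into \<open>op_B\<close>,
  so results on \<open>phi\<close> carry over to \<open>Psi\<close>.\<close>

lemma Psi_eq_phi: "Psi w = phi (\<lambda>x. cnj (w x))"
proof -
  have "op_A_dagger w = op_B (\<lambda>x. cnj (w x))"
    by (intro ext) (simp add: op_A_dagger_def op_B_def)
  then show ?thesis by (intro ext) (simp add: Psi_def phi_def)
qed

lemma phi0_has_vector_derivative:
  assumes "(s has_vector_derivative w x) (at x)"
  shows "(phi0 N s has_vector_derivative - w x * phi0 N s x) (at x)"
proof -
  have "((\<lambda>x. exp (- s x)) has_vector_derivative - w x * exp (- s x)) (at x)"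
    using field_vector_diff_chain_at[OF has_vector_derivative_minus[OF assms] DERIV_exp]
    by (simp add: o_def)
  from has_vector_derivative_mult_right[OF this, of N]
  show ?thesis by (simp add: phi0_def algebra_simps)
qed

lemma Psi0_eq_phi0: "Psi0 N s = phi0 N (\<lambda>x. cnj (s x))"
  by (simp add: Psi0_def phi0_def)

text \<open>Each derivative contributes a sign and, by the chain rule for
  \<open>sqrt 2 * t - k\<close>, a factor \<open>sqrt 2\<close>; \<open>sqrt (fact n)\<close> undoes
  the normalisation of \<open>p\<close>. The parameter \<open>k\<close> is arbitrary, since the left
  side does not contain it.\<close>

lemma funpow_deriv_gaussian:
  "(deriv ^^ n) (\<lambda>t. exp (- t\<^sup>2))
    = (\<lambda>t. (-1) ^ n * sqrt (2 ^ n * fact n) * p n k (sqrt 2 * t - k) * exp (- t\<^sup>2))"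
proof (induction n)
  case 0
  show ?case by simp
next
  case (Suc n)
  show ?case
  proof
    fix t :: real
    let ?x = "sqrt 2 * t - k" and ?c = "(-1) ^ n * sqrt (2 ^ n * fact n)"
    have "((\<lambda>t. sqrt 2 * t - k) has_field_derivative sqrt 2) (at t)"
      by (auto intro!: derivative_eq_intros)
    from DERIV_chain2[OF p_has_field_derivative this]
    have "((\<lambda>t. p n k (sqrt 2 * t - k)) has_field_derivative deriv (p n k) ?x * sqrt 2) (at t)" .
    then have "((\<lambda>t. ?c * p n k (sqrt 2 * t - k) * exp (- t\<^sup>2)) has_field_derivative
        ?c * (deriv (p n k) ?x * sqrt 2 - 2 * t * p n k ?x) * exp (- t\<^sup>2)) (at t)"
      by (auto intro!: derivative_eq_intros simp: algebra_simps)
    then have "(deriv ^^ Suc n) (\<lambda>t. exp (- t\<^sup>2)) t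
        = ?c * (deriv (p n k) ?x * sqrt 2 - 2 * t * p n k ?x) * exp (- t\<^sup>2)"
      by (simp add: Suc DERIV_imp_deriv)
    \<comment> \<open>Here \<open>?x + k = sqrt 2 * t\<close>, hence
      \<open>2 * t = sqrt 2 * (?x + k)\<close> and \<open>sqrt 2\<close> factors out.\<close>
    also have "deriv (p n k) ?x * sqrt 2 - 2 * t * p n k ?x
        = - (sqrt 2 * ((?x + k) * p n k ?x - deriv (p n k) ?x))"
      by (simp add: algebra_simps)
    also have "?c * \<dots> = (-1) ^ Suc n * (sqrt (2 ^ Suc n)
        * (sqrt (fact n) * ((?x + k) * p n k ?x - deriv (p n k) ?x)))"
      by (simp add: real_sqrt_mult)
    also have "\<dots> = (-1) ^ Suc n * sqrt (2 ^ Suc n * fact (Suc n)) * p (Suc n) k ?x"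
      unfolding sqrt_fact_Suc_mult_p[symmetric] real_sqrt_mult by (simp only: mult.assoc)
    finally show "(deriv ^^ Suc n) (\<lambda>t. exp (- t\<^sup>2)) t
        = (-1) ^ Suc n * sqrt (2 ^ Suc n * fact (Suc n)) * p (Suc n) k ?x * exp (- t\<^sup>2)" .
  qed
qed

lemma p_eq_Hermite: "p n k x = 1 / sqrt (2 ^ n * fact n) * Hermite n ((x + k) / sqrt 2)"
proof -
  let ?y = "(x + k) / sqrt 2"
  \<comment> \<open>At \<open>t = ?y\<close> the argument \<open>sqrt 2 * t - k\<close> is
    \<open>x\<close>. The signs and the exponentials then cancel in pairs.\<close>
  have "Hermite n ?y
      = ((-1) ^ n * (-1) ^ n) * (exp (?y\<^sup>2) * exp (- ?y\<^sup>2)) * sqrt (2 ^ n * fact n) * p n k x"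
    by (simp add: Hermite_def funpow_deriv_gaussian[of n k])
  also have "\<dots> = sqrt (2 ^ n * fact n) * p n k x"
    by (simp flip: exp_add power_mult_distrib)
  finally show ?thesis by simp
qed

theorem proposition4:
  fixes k :: real
    and w\<^sub>A w\<^sub>B s\<^sub>A s\<^sub>B :: "real \<Rightarrow> complex"
    and N\<^sub>\<phi> N\<^sub>\<Psi> :: complex
  assumes "smooth w\<^sub>A" and "smooth w\<^sub>B"
    and "w\<^sub>A \<noteq> (\<lambda>x. cnj (w\<^sub>B x))"
    and "\<And>x. w\<^sub>A x + w\<^sub>B x = complex_of_real (x + k)"
    and "\<And>x. (s\<^sub>A has_vector_derivative w\<^sub>A x) (at x)"
    and "\<And>x. (s\<^sub>B has_vector_derivative w\<^sub>B x) (at x)"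
    and "\<And>x. s\<^sub>A x + s\<^sub>B x = complex_of_real (x\<^sup>2 / 2 + k * x)"
    and "N\<^sub>\<phi> \<noteq> 0" and "N\<^sub>\<Psi> \<noteq> 0"
    and "N\<^sub>\<phi> * cnj N\<^sub>\<Psi> = complex_of_real (exp (- k\<^sup>2 / 2) / sqrt (2 * pi))"
  defines "\<phi>\<^sub>0 \<equiv> phi0 N\<^sub>\<phi> s\<^sub>A" and "\<Psi>\<^sub>0 \<equiv> Psi0 N\<^sub>\<Psi> s\<^sub>B"
  shows "(\<forall>n x. phi w\<^sub>B \<phi>\<^sub>0 n x / \<phi>\<^sub>0 x = complex_of_real (p n k x)
              \<and> Psi w\<^sub>A \<Psi>\<^sub>0 n x / \<Psi>\<^sub>0 x = complex_of_real (p n k x))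
       \<and> (\<forall>n x. p n k x = 1 / sqrt (2 ^ n * fact n) * Hermite n ((x + k) / sqrt 2))"
proof (intro conjI allI)
  fix n x
  show "phi w\<^sub>B \<phi>\<^sub>0 n x / \<phi>\<^sub>0 x = complex_of_real (p n k x)"
  proof (rule phi_div_vacuum[where v = w\<^sub>A])
    show "(\<phi>\<^sub>0 has_vector_derivative - w\<^sub>A x * \<phi>\<^sub>0 x) (at x)" for x
      unfolding \<phi>\<^sub>0_def by (rule phi0_has_vector_derivative[OF assms(5)])
    show "\<phi>\<^sub>0 x \<noteq> 0"
      using assms(8) by (simp add: \<phi>\<^sub>0_def phi0_def)
  qed (rule assms(4))
  show "Psi w\<^sub>A \<Psi>\<^sub>0 n x / \<Psi>\<^sub>0 x = complex_of_real (p n k x)"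
    unfolding Psi_eq_phi
  \<comment> \<open>The exponent of the vacuum is now \<open>- cnj (s\<^sub>B x)\<close>, which
    fixes \<open>v\<close>.\<close>
  proof (rule phi_div_vacuum[where v = "\<lambda>x. cnj (w\<^sub>B x)"])
    show "(\<Psi>\<^sub>0 has_vector_derivative - cnj (w\<^sub>B x) * \<Psi>\<^sub>0 x) (at x)" for x
      unfolding \<Psi>\<^sub>0_def Psi0_eq_phi0
      by (rule phi0_has_vector_derivative[OF has_vector_derivative_cnj[OF assms(6)]])
    show "cnj (w\<^sub>B x) + cnj (w\<^sub>A x) = complex_of_real (x + k)" for x
      \<comment> \<open>Conjugation leaves \<open>x + k\<close> unchanged because it is real; hence
        both families share the same \<open>p\<close>.\<close>
      using arg_cong[OF assms(4), of cnj x] by (simp add: add.commute)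
    show "\<Psi>\<^sub>0 x \<noteq> 0"
      using assms(9) by (simp add: \<Psi>\<^sub>0_def Psi0_def)
  qed
  show "p n k x = 1 / sqrt (2 ^ n * fact n) * Hermite n ((x + k) / sqrt 2)"
    by (rule p_eq_Hermite)
qed

end
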